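(* Suppose $x_*\in T^{-1}(0)$. Let $\{x_k\}$ be the iterative sequence generated by the following PPA: given $\lambda>0$, $x_0\in\mathcal H$, $a_{k+1}\ge\varepsilon>0$, and $\delta_k\ge 0$ satisfying $\sum_{k\ge 0}\delta_k<+\infty$, find $x_{k+1}$ such that $$0=a_{k+1}T_\lambda(x_{k+1})+x_{k+1}-x_k+g_k,\qquad k=0,1,\dots,$$ where $g_k\in\mathcal H$ satisfies $\|g_k\|\le\delta_k$. Then: (1) $\{x_k\}$ is bounded. (2) $\sum_{i=0}^{+\infty}\|x_{i+1}-x_i\|^2<+\infty$. (3) $\|T_\lambda(x_{k+1})\|=o(1/a_{k+1})$ and $\mathtt{Gap}(x_{k+1})=o(1/a_{k+1})$. (4) $\mathtt{Gap}(\widetilde x_{k+1})\le O\big(1/\sum_{i=0}^{k}a_{i+1}\big)$, where $\widetilde x_{k+1}=\frac{1}{\sum_{i=0}^{k}a_{i+1}}\sum_{i=0}^{k}a_{i+1}x_{i+1}$. (5) $\{x_k\}$ converges weakly to a solution of the problem of finding $x\in\mathcal H$ such that $0\in Tx$. (6) In the case when $\delta_k\equiv 0$, it holds that $\|T_\lambda(x_{k+1})\|\le O\Big(1/\sqrt{\sum_{i=0}^{k}a_{i+1}^2}\Big)$ and $\mathtt{Gap}(x_{k+1})\le O\Big(1/\sqrt{\sum_{i=0}^{k}a_{i+1}^2}\Big)$.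
   Context: $\mathcal H$ is a real Hilbert space with inner product $\langle\cdot,\cdot\rangle$ and corresponding norm $\|\cdot\|$. $T$ is a (set-valued) maximally monotone operator on $\mathcal H$ such that $T^{-1}(0)=\{x\in\mathcal H:0\in Tx\}$ is nonempty and bounded. For $\lambda>0$, the resolvent is $J_{\lambda T}=(I+\lambda T)^{-1}$ and the Yosida regularization is $T_\lambda=\frac1\lambda(I-J_{\lambda T})$, a single-valued map on $\mathcal H$. For $x_0\in\mathcal H$ (the initial point) and $D>0$, $\mathbb B(x_0,D)=\{y\in\mathcal H:\|y-x_0\|\le D\}$ and $\mathtt{Gap}(x)=\max_{y\in\mathbb B(x_0,D)}\langle x-y,T_\lambda(y)\rangle$. The symbols $o(\cdot)$ and $O(\cdot)$ are the usual Landau symbols as $k\to\infty$.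
   Formalization: In (3), Gap(x_{k+1}) = o(1/a_{k+1}) fails if B(x_0,D) contains no solution; it is proved as an upper bound for every D>0, and as stated when the ball contains a solution or eventually all iterates. The max in Gap is read as a supremum. *)

theory Defs
  imports "HOL-Analysis.Analysis" "HOL-Library.Landau_Symbols"
begin

text \<open>A set-valued operator on a space \<open>'a\<close> is a function \<open>'a \<Rightarrow> 'a set\<close>; its graph is
  the set of pairs \<open>(x, u)\<close> with \<open>u \<in> T x\<close>.  Real Hilbert spaces are the types of sort
  \<open>{real_inner, complete_space}\<close>.\<close>

definition monotone_operator :: "('a::real_inner \<Rightarrow> 'a set) \<Rightarrow> bool" where
  "monotone_operator T \<longleftrightarrow>
     (\<forall>x y. \<forall>u\<in>T x. \<forall>v\<in>T y. 0 \<le> (x - y) \<bullet> (u - v))"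

definition maximally_monotone :: "('a::real_inner \<Rightarrow> 'a set) \<Rightarrow> bool" where
  "maximally_monotone T \<longleftrightarrow> monotone_operator T \<and>
     (\<forall>S. monotone_operator S \<and> (\<forall>x. T x \<subseteq> S x) \<longrightarrow> S = T)"

definition inverse_operator :: "('a \<Rightarrow> 'b set) \<Rightarrow> 'b \<Rightarrow> 'a set" where
  "inverse_operator T y = {x. y \<in> T x}"

text \<open>The set \<open>(I + lam T)\<^sup>-\<^sup>1(x)\<close> is a singleton for every \<open>x\<close> if \<open>T\<close> is maximally monotone
  and \<open>lam > 0\<close> (Minty); only then is its element \<open>resolvent lam T x\<close> meaningful.\<close>

definition resolvent :: "real \<Rightarrow> ('a::real_inner \<Rightarrow> 'a set) \<Rightarrow> 'a \<Rightarrow> 'a" where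
  "resolvent lam T x = the_elem (inverse_operator (\<lambda>z. {z + lam *\<^sub>R u |u. u \<in> T z}) x)"

definition yosida :: "real \<Rightarrow> ('a::real_inner \<Rightarrow> 'a set) \<Rightarrow> 'a \<Rightarrow> 'a" where
  "yosida lam T x = (1 / lam) *\<^sub>R (x - resolvent lam T x)"

text \<open>The maximum in the definition of the gap function need not be attained in infinite
  dimension, so it is read as a supremum.  For maximally monotone \<open>T\<close>, \<open>lam > 0\<close> and \<open>D \<ge> 0\<close> it is
  taken over a nonempty set that is bounded above, the Yosida regularization being Lipschitz.\<close>

definition gap :: "real \<Rightarrow> ('a::real_inner \<Rightarrow> 'a set) \<Rightarrow> 'a \<Rightarrow> real \<Rightarrow> 'a \<Rightarrow> real" where
  "gap lam T x0 D x = (SUP y\<in>cball x0 D. (x - y) \<bullet> yosida lam T y)"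

definition weakly_converges :: "(nat \<Rightarrow> 'a::real_normed_vector) \<Rightarrow> 'a \<Rightarrow> bool" where
  "weakly_converges x z \<longleftrightarrow>
     (\<forall>f :: 'a \<Rightarrow> real. bounded_linear f \<longrightarrow> (\<lambda>k. f (x k)) \<longlonglongrightarrow> f z)"

text \<open>One-sided Landau bounds \<open>f \<le> O(g)\<close> and \<open>f \<le> o(g)\<close>: unlike \<open>f \<in> O(g)\<close> and \<open>f \<in> o(g)\<close>, they
  bound \<open>f\<close> only from above.  The gap function can be negative outside \<open>cball x0 D\<close>: if
  \<open>T\<close> is the identity and \<open>0 \<notin> cball x0 D\<close>, it is negative at \<open>0\<close>.\<close>

definition le_bigo :: "(nat \<Rightarrow> real) \<Rightarrow> (nat \<Rightarrow> real) \<Rightarrow> bool" where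
  "le_bigo f g \<longleftrightarrow> (\<exists>h \<in> O(g). \<forall>k. f k \<le> h k)"

definition le_smallo :: "(nat \<Rightarrow> real) \<Rightarrow> (nat \<Rightarrow> real) \<Rightarrow> bool" where
  "le_smallo f g \<longleftrightarrow> (\<exists>h \<in> o(g). \<forall>k. f k \<le> h k)"

end

theory Submission imports Defs begin

text \<open>The step equation moves \<open>x\<^sub>k\<close> by \<open>- a\<^sub>k\<^sub>+\<^sub>1 A(x\<^sub>k\<^sub>+\<^sub>1) - g\<^sub>k\<close>, where \<open>A\<close> is the Yosida
  regularization, a monotone map with the same zeros as \<open>T\<close>.  Such a step increases the distance to
  a zero by at most \<open>\<delta>\<^sub>k\<close> (\<open>quasi_fejer\<close>), so these distances converge and the iterates are bounded.
  Pairing the step equation with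
  \<open>x\<^sub>k\<^sub>+\<^sub>1 - y\<close> gives, for every \<open>y\<close>, the energy inequality
  \<open>2 a\<^sub>k\<^sub>+\<^sub>1 \<langle>x\<^sub>k\<^sub>+\<^sub>1 - y, A x\<^sub>k\<^sub>+\<^sub>1\<rangle> + \<parallel>x\<^sub>k\<^sub>+\<^sub>1 - x\<^sub>k\<parallel>\<^sup>2 \<le> \<parallel>x\<^sub>k - y\<parallel>\<^sup>2 - \<parallel>x\<^sub>k\<^sub>+\<^sub>1 - y\<parallel>\<^sup>2 + O(\<delta>\<^sub>k)\<close>,
  whose right-hand side telescopes (\<open>energy_sum_le\<close>).  At a zero \<open>y\<close> of \<open>A\<close> the inner product is
  nonnegative, so the squared steps are summable; since the scaled residual \<open>a\<^sub>k\<^sub>+\<^sub>1 A(x\<^sub>k\<^sub>+\<^sub>1)\<close> is a step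
  up to an error \<open>g\<^sub>k\<close>, it tends to \<open>0\<close>.  At an arbitrary point \<open>y\<close> of the ball, monotonicity
  replaces \<open>A x\<^sub>k\<^sub>+\<^sub>1\<close> by \<open>A y\<close>, and dividing by the sum of the \<open>a\<^sub>i\<close> bounds the gap of the averages.
  Without errors the residuals \<open>\<parallel>A x\<^sub>k\<parallel>\<close> decrease, so the last one is bounded by their
  \<open>a\<^sub>i\<^sup>2\<close>-weighted quadratic mean.  Finally the gap at \<open>p\<close> is at most a constant times
  \<open>\<parallel>A p\<parallel>\<close> for bounded \<open>p\<close>, again by monotonicity, so all rates for the residual carry over.

  Two results of functional analysis enter: Minty's theorem (\<open>minty\<close>), without which the resolvent
  need not be defined, and Opial's lemma (\<open>opial_weak_convergence\<close>), which gives the weak limit.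
  Both, and the Riesz representation of the functionals that test weak convergence, come from the
  single fact that a strongly convex lower semicontinuous function attains its minimum and grows
  quadratically away from it (\<open>strongly_convex_minimizer\<close>).  That fact needs only completeness:
  minimizing sequences are Cauchy by the parallelogram law, so no weak compactness is used.\<close>

section \<open>Minimizing strongly convex functions\<close>

lemma norm_convex_combination_sq:
  fixes z w :: "'a::real_inner"
  shows "(norm ((1 - t) *\<^sub>R z + t *\<^sub>R w))\<^sup>2
    = (1 - t) * (norm z)\<^sup>2 + t * (norm w)\<^sup>2 - t * (1 - t) * (norm (z - w))\<^sup>2"
  by (simp add: power2_norm_eq_inner inner_add inner_diff inner_commute[of w z] algebra_simps)

text \<open>The function is given by its epigraph \<open>E\<close>, so that it may be infinite at some points, as the
  Fitzpatrick function below is; closedness of \<open>E\<close> is lower semicontinuity.  Points of \<open>E\<close> whose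
  heights are close to the infimum are close to each other, because otherwise their midpoint would
  lie below the infimum.\<close>
lemma strongly_convex_minimizer:
  fixes E :: "('a::{real_inner, complete_space} \<times> real) set"
  assumes "closed E" and "E \<noteq> {}" and bdd: "bdd_below (snd ` E)"
    and convex: "\<And>z r w s t. \<lbrakk>(z, r) \<in> E; (w, s) \<in> E; 0 \<le> t; t \<le> 1\<rbrakk> \<Longrightarrow>
      ((1 - t) *\<^sub>R z + t *\<^sub>R w, (1 - t) * r + t * s - t * (1 - t) / 2 * (norm (z - w))\<^sup>2) \<in> E"
  obtains c m where "(c, m) \<in> E" and "\<And>z r. (z, r) \<in> E \<Longrightarrow> m + (norm (z - c))\<^sup>2 / 2 \<le> r"
proof -
  define m where "m = Inf (snd ` E)"
  have m_le: "m \<le> r" if "(z, r) \<in> E" for z r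
    unfolding m_def using that bdd by (intro cInf_lower) force+
  have "\<exists>p. p \<in> E \<and> snd p < m + 1 / Suc n" for n
  proof -
    have "\<exists>r\<in>snd ` E. r < m + 1 / Suc n"
      unfolding m_def using \<open>E \<noteq> {}\<close> bdd by (subst cInf_less_iff[symmetric]) auto
    then show ?thesis by blast
  qed
  then obtain p where p: "\<And>n. p n \<in> E" "\<And>n. snd (p n) < m + 1 / Suc n" by metis
  define z where "z = fst \<circ> p"
  define r where "r = snd \<circ> p"
  have zr: "(z n, r n) \<in> E" "r n < m + 1 / Suc n" for n
    using p by (auto simp: z_def r_def)
  have r_lim: "r \<longlonglongrightarrow> m"
  proof (rule tendsto_sandwich[OF _ _ tendsto_const])
    show "(\<lambda>n. m + 1 / Suc n) \<longlonglongrightarrow> m"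
      using tendsto_add[OF tendsto_const[of m] LIMSEQ_inverse_real_of_nat]
      by (simp add: inverse_eq_divide)
    show "\<forall>\<^sub>F n in sequentially. m \<le> r n" using m_le[OF zr(1)] by simp
    show "\<forall>\<^sub>F n in sequentially. r n \<le> m + 1 / Suc n" using less_imp_le[OF zr(2)] by (rule always_eventually[OF allI])
  qed
  have close: "(norm (z n - z k))\<^sup>2 / 4 \<le> 1 / Suc n + 1 / Suc k" for n k
  proof -
    have "m \<le> (1 - 1/2) * r n + 1/2 * r k - 1/2 * (1 - 1/2) / 2 * (norm (z n - z k))\<^sup>2"
      by (rule m_le[OF convex[OF zr(1) zr(1)]]) auto
    moreover have "2 * r n + 2 * r k \<le> 4 * m + 2 * (1 / Suc n) + 2 * (1 / Suc k)"
      using zr(2)[of n] zr(2)[of k] by linarith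
    ultimately show ?thesis by simp
  qed
  have "Cauchy z"
  proof (rule metric_CauchyI)
    fix e :: real assume e: "e > 0"
    then obtain N where N: "inverse (real (Suc N)) < e\<^sup>2 / 8"
      using reals_Archimedean[of "e\<^sup>2/8"] by auto
    have "dist (z n) (z k) < e" if "n \<ge> N" "k \<ge> N" for n k
    proof -
      have "1 / real (Suc n) \<le> inverse (real (Suc N))" "1 / real (Suc k) \<le> inverse (real (Suc N))"
        using that by (auto simp: divide_simps)
      with close[of n k] N have "(norm (z n - z k))\<^sup>2 < e\<^sup>2" by linarith
      then show ?thesis using e by (simp add: dist_norm power_less_imp_less_base)
    qed
    then show "\<exists>N. \<forall>n\<ge>N. \<forall>k\<ge>N. dist (z n) (z k) < e" by blast
  qed
  then obtain c where c: "z \<longlonglongrightarrow> c" using Cauchy_convergent_iff convergent_def by blast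
  have cm: "(c, m) \<in> E"
    using closed_sequentially[OF \<open>closed E\<close>, of "\<lambda>n. (z n, r n)"] zr(1) tendsto_Pair[OF c r_lim]
    by auto
  moreover have "m + (norm (w - c))\<^sup>2 / 2 \<le> s" if ws: "(w, s) \<in> E" for w s
  proof -
    \<comment> \<open>The segment from the minimizer to \<open>w\<close> stays above level \<open>m\<close>; divide by \<open>t\<close> and let it
      tend to \<open>0\<close>.\<close>
    have bound: "(1 - t) * ((norm (w - c))\<^sup>2 / 2) \<le> s - m" if "0 < t" "t \<le> 1" for t
    proof -
      have "m \<le> (1 - t) * m + t * s - t * (1 - t) / 2 * (norm (c - w))\<^sup>2"
        using that by (intro m_le[OF convex[OF cm ws]]) auto
      then have "t * ((1 - t) * ((norm (w - c))\<^sup>2 / 2)) \<le> t * (s - m)"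
        by (simp add: norm_minus_commute algebra_simps)
      then show ?thesis using that by simp
    qed
    have "((\<lambda>t. (1 - t) * ((norm (w - c))\<^sup>2 / 2)) \<longlongrightarrow> (1 - 0) * ((norm (w - c))\<^sup>2 / 2)) (at_right 0)"
      by (intro tendsto_intros)
    moreover have "\<forall>\<^sub>F t in at_right 0. (1 - t) * ((norm (w - c))\<^sup>2 / 2) \<le> s - m"
      unfolding eventually_at_right_field using bound by (intro exI[of _ 1]) auto
    ultimately have "(1 - 0) * ((norm (w - c))\<^sup>2 / 2) \<le> s - m"
      by (rule tendsto_upperbound) auto
    then show ?thesis by simp
  qed
  ultimately show ?thesis by (rule that)
qed

text \<open>The representing vector is the minimizer of \<open>\<parallel>z\<parallel>\<^sup>2 / 2 - f z\<close>: quadratic growth around it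
  cancels the quadratic part and leaves a linear functional bounded from above, hence zero.\<close>
lemma riesz_representation:
  fixes f :: "'a::{real_inner, complete_space} \<Rightarrow> real"
  assumes "bounded_linear f"
  obtains h where "\<And>z. f z = z \<bullet> h"
proof -
  interpret f: bounded_linear f by fact
  define E where "E = {(z, r). (norm z)\<^sup>2 / 2 - f z \<le> r}"
  obtain K where K: "\<And>z. norm (f z) \<le> norm z * K" using f.bounded by blast
  have "closed E"
    unfolding E_def case_prod_unfold
    by (auto intro!: closed_Collect_le continuous_intros f.continuous_on)
  moreover have "E \<noteq> {}" unfolding E_def by auto
  moreover have "bdd_below (snd ` E)"
  proof (rule bdd_belowI)
    fix r assume "r \<in> snd ` E"
    then obtain z where z: "(norm z)\<^sup>2 / 2 - f z \<le> r" by (auto simp: E_def)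
    have "0 \<le> (norm z - K)\<^sup>2" by simp
    then show "- K\<^sup>2 / 2 \<le> r" using z K[of z] by (simp add: power2_diff abs_le_iff)
  qed
  moreover have "((1 - t) *\<^sub>R z + t *\<^sub>R w, (1 - t) * r + t * s - t * (1 - t) / 2 * (norm (z - w))\<^sup>2) \<in> E"
    if "(z, r) \<in> E" "(w, s) \<in> E" "0 \<le> t" "t \<le> 1" for z r w s t
  proof -
    have "(1 - t) * ((norm z)\<^sup>2 / 2 - f z) \<le> (1 - t) * r" "t * ((norm w)\<^sup>2 / 2 - f w) \<le> t * s"
      using that by (auto simp: E_def intro!: mult_left_mono)
    moreover have "(norm ((1 - t) *\<^sub>R z + t *\<^sub>R w))\<^sup>2 / 2 - f ((1 - t) *\<^sub>R z + t *\<^sub>R w)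
        = (1 - t) * ((norm z)\<^sup>2 / 2 - f z) + t * ((norm w)\<^sup>2 / 2 - f w) - t * (1 - t) / 2 * (norm (z - w))\<^sup>2"
      by (simp only: norm_convex_combination_sq f.add f.scaleR) (simp add: field_simps)
    ultimately show ?thesis by (simp add: E_def)
  qed
  ultimately obtain c m where cm: "(c, m) \<in> E" "\<And>z r. (z, r) \<in> E \<Longrightarrow> m + (norm (z - c))\<^sup>2 / 2 \<le> r"
    using strongly_convex_minimizer[of E] by blast
  have above: "f z \<le> z \<bullet> c + (f c - c \<bullet> c)" for z
  proof -
    have "m + (norm (z - c))\<^sup>2 / 2 \<le> (norm z)\<^sup>2 / 2 - f z" by (rule cm(2)) (simp add: E_def)
    moreover have "(norm c)\<^sup>2 / 2 - f c \<le> m" using cm(1) by (simp add: E_def)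
    ultimately show ?thesis
      by (simp add: power2_norm_eq_inner inner_diff inner_commute[of c z] field_simps)
  qed
  have "f z - z \<bullet> c = 0" for z
  proof (rule ccontr)
    assume nz: "f z - z \<bullet> c \<noteq> 0"
    have "t * (f z - z \<bullet> c) \<le> f c - c \<bullet> c" for t
      using above[of "t *\<^sub>R z"] by (simp add: f.scaleR algebra_simps)
    from this[of "(f c - c \<bullet> c + 1) / (f z - z \<bullet> c)"] nz show False by simp
  qed
  then show ?thesis using that[of c] by simp
qed

section \<open>Minty's theorem\<close>

text \<open>Otherwise adjoining \<open>(x, u)\<close> to the graph would give a proper monotone extension of \<open>T\<close>.\<close>
lemma maximally_monotone_related:
  assumes T: "maximally_monotone T" and rel: "\<And>y v. v \<in> T y \<Longrightarrow> 0 \<le> (x - y) \<bullet> (u - v)"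
  shows "u \<in> T x"
proof -
  define S where "S = T(x := insert u (T x))"
  have "0 \<le> (p - q) \<bullet> (r - s)" if "r \<in> S p" "s \<in> S q" for p q r s
  proof -
    have mono: "r \<in> T p \<Longrightarrow> s \<in> T q \<Longrightarrow> 0 \<le> (p - q) \<bullet> (r - s)"
      using T by (auto simp: maximally_monotone_def monotone_operator_def)
    have swap: "(p - x) \<bullet> (r - u) = (x - p) \<bullet> (u - r)"
      by (simp add: inner_diff)
    show ?thesis using that mono rel[of r p] rel[of s q] swap
      by (auto simp: S_def split: if_splits)
  qed
  then have "monotone_operator S" by (auto simp: monotone_operator_def)
  moreover have "\<forall>y. T y \<subseteq> S y" by (auto simp: S_def)
  ultimately have "S = T" using T by (auto simp: maximally_monotone_def)
  then show ?thesis by (auto simp: S_def fun_eq_iff split: if_splits)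
qed

lemma maximally_monotoneI:
  assumes "monotone_operator T"
    and "\<And>x u. (\<And>y v. v \<in> T y \<Longrightarrow> 0 \<le> (x - y) \<bullet> (u - v)) \<Longrightarrow> u \<in> T x"
  shows "maximally_monotone T"
  unfolding maximally_monotone_def
proof (intro conjI allI impI)
  fix S assume S: "monotone_operator S \<and> (\<forall>x. T x \<subseteq> S x)"
  have "S x \<subseteq> T x" for x
  proof
    fix u assume "u \<in> S x"
    then show "u \<in> T x" using S by (intro assms(2)) (meson monotone_operator_def subsetD)
  qed
  then show "S = T" using S by (intro ext) blast
qed fact

text \<open>Let \<open>F(x, u) = sup {\<langle>x, v\<rangle> + \<langle>u, y\<rangle> - \<langle>y, v\<rangle> | v \<in> T y}\<close> be the Fitzpatrick function.  Adding
  \<open>(\<parallel>x\<parallel>\<^sup>2 + \<parallel>u\<parallel>\<^sup>2) / 2\<close> to it makes it strongly convex, and maximality of \<open>T\<close> says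
  \<open>F(x, u) \<ge> \<langle>x, u\<rangle>\<close>, with equality on the graph of \<open>T\<close>.  Comparing the minimizer \<open>(x, u)\<close> with the
  points of the graph shows that \<open>(-u, -x)\<close> is monotonically related to the graph, hence lies in it,
  and then that \<open>u = -x\<close>.\<close>
lemma minty_at_zero:
  fixes T :: "'a::{real_inner, complete_space} \<Rightarrow> 'a set"
  assumes T: "maximally_monotone T"
  obtains z where "- z \<in> T z"
proof -
  have mono: "0 \<le> (x - y) \<bullet> (u - v)" if "u \<in> T x" "v \<in> T y" for x y u v
    using T that by (auto simp: maximally_monotone_def monotone_operator_def)
  obtain y0 v0 where graph: "v0 \<in> T y0"
    using maximally_monotone_related[OF T, of 0 0] by (cases "\<forall>y. T y = {}") auto
  \<comment> \<open>Completing the square turns the term of \<open>(y, v)\<close> in the regularized supremum into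
    \<open>h y v\<close>, a translate of half the squared norm on the product space.\<close>
  define h where "h = (\<lambda>y v (p :: 'a \<times> 'a).
    (norm (p + (v, y)))\<^sup>2 / 2 - (norm (y + v))\<^sup>2 / 2)"
  define E where "E = {(p, r). \<forall>y v. v \<in> T y \<longrightarrow> h y v p \<le> r}"
  have h_eq: "h y v (x, u) = (norm (x + u))\<^sup>2 / 2 - (x - y) \<bullet> (u - v)" for x u y v
    unfolding h_def
    by (simp add: norm_prod_def)
      (simp add: power2_norm_eq_inner inner_add inner_diff inner_commute field_simps)
  have "closed E"
  proof -
    have "E = (\<Inter>y. \<Inter>v\<in>T y. {q. h y v (fst q) \<le> snd q})" by (auto simp: E_def)
    moreover have "closed {q. h y v (fst q) \<le> snd q}" for y v
      unfolding h_def by (intro closed_Collect_le continuous_intros) auto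
    ultimately show ?thesis by auto
  qed
  have graph_in: "((y, v), (norm (y + v))\<^sup>2 / 2) \<in> E" if "v \<in> T y" for y v
    using mono that by (auto simp: E_def h_eq)
  have "E \<noteq> {}" using graph_in[OF graph] by auto
  moreover have "bdd_below (snd ` E)"
  proof (rule bdd_belowI)
    fix r assume "r \<in> snd ` E"
    then obtain p where "(p, r) \<in> E" by auto
    then have "h y0 v0 p \<le> r" using graph by (simp add: E_def)
    moreover have "- (norm (y0 + v0))\<^sup>2 / 2 \<le> h y0 v0 p" by (simp add: h_def)
    ultimately show "- (norm (y0 + v0))\<^sup>2 / 2 \<le> r" by linarith
  qed
  moreover have "((1 - t) *\<^sub>R p + t *\<^sub>R q, (1 - t) * r + t * s - t * (1 - t) / 2 * (norm (p - q))\<^sup>2) \<in> E"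
    if pq: "(p, r) \<in> E" "(q, s) \<in> E" and t: "0 \<le> t" "t \<le> 1" for p r q s t
  proof -
    have "h y v ((1 - t) *\<^sub>R p + t *\<^sub>R q) \<le> (1 - t) * r + t * s - t * (1 - t) / 2 * (norm (p - q))\<^sup>2"
      if "v \<in> T y" for y v
    proof -
      have *: "(1 - t) * h y v p \<le> (1 - t) * r" "t * h y v q \<le> t * s"
        using pq t that by (auto simp: E_def intro!: mult_left_mono)
      have "(1 - t) *\<^sub>R p + t *\<^sub>R q + (v, y) = (1 - t) *\<^sub>R (p + (v, y)) + t *\<^sub>R (q + (v, y))"
        by (simp add: algebra_simps)
      then have "(norm ((1 - t) *\<^sub>R p + t *\<^sub>R q + (v, y)))\<^sup>2 = (1 - t) * (norm (p + (v, y)))\<^sup>2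
          + t * (norm (q + (v, y)))\<^sup>2 - t * (1 - t) * (norm (p - q))\<^sup>2"
        by (simp only: norm_convex_combination_sq) simp
      then have "h y v ((1 - t) *\<^sub>R p + t *\<^sub>R q)
          = (1 - t) * h y v p + t * h y v q - t * (1 - t) / 2 * (norm (p - q))\<^sup>2"
        by (simp add: h_def field_simps)
      then show ?thesis using * by linarith
    qed
    then show ?thesis by (simp add: E_def)
  qed
  ultimately obtain c m where "(c, m) \<in> E"
    and least: "\<And>p r. (p, r) \<in> E \<Longrightarrow> m + (norm (p - c))\<^sup>2 / 2 \<le> r"
    using \<open>closed E\<close> strongly_convex_minimizer[of E] by blast
  then obtain x u where c: "c = (x, u)" and min: "((x, u), m) \<in> E" by (cases c) auto
  have m: "(norm (x + u))\<^sup>2 / 2 \<le> m"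
  proof (rule ccontr)
    assume "\<not> ?thesis"
    then have pos: "0 < (x - y) \<bullet> (u - v)" if "v \<in> T y" for y v
      using min that by (fastforce simp: E_def h_eq)
    then have "u \<in> T x" using maximally_monotone_related[OF T] by (meson less_imp_le)
    then show False using pos[of u x] by simp
  qed
  have related: "(norm (x + u))\<^sup>2 \<le> (- u - y) \<bullet> (- x - v)" if "v \<in> T y" for y v
  proof -
    have "m + (norm ((y, v) - (x, u)))\<^sup>2 / 2 \<le> (norm (y + v))\<^sup>2 / 2"
      using least[OF graph_in[OF that]] by (simp only: c)
    with m have "(norm (x + u))\<^sup>2 / 2 + ((norm (y - x))\<^sup>2 + (norm (v - u))\<^sup>2) / 2 \<le> (norm (y + v))\<^sup>2 / 2"
      by (simp add: norm_prod_def)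
    then show ?thesis
      by (simp add: power2_norm_eq_inner inner_add inner_diff inner_commute field_simps)
  qed
  have in_T: "- x \<in> T (- u)"
    using related by (intro maximally_monotone_related[OF T]) (meson order_trans zero_le_power2)
  from related[OF this] have "x + u = 0" by simp
  then have "- u = x" by (simp add: eq_neg_iff_add_eq_0 neg_eq_iff_add_eq_0 add.commute)
  with in_T show ?thesis by (intro that[of x]) simp
qed

text \<open>The equation \<open>p \<in> z + lam T z\<close> is the case of the previous lemma for the maximally monotone
  operator \<open>z \<mapsto> lam T z - p\<close>.\<close>
theorem minty:
  fixes T :: "'a::{real_inner, complete_space} \<Rightarrow> 'a set"
  assumes T: "maximally_monotone T" and "lam > 0"
  obtains z u where "u \<in> T z" "z + lam *\<^sub>R u = p"
proof -
  define S where "S = (\<lambda>z. (\<lambda>u. lam *\<^sub>R u - p) ` T z)"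
  have "maximally_monotone S"
  proof (rule maximally_monotoneI)
    show "monotone_operator S"
      using T \<open>lam > 0\<close>
      by (auto simp: S_def maximally_monotone_def monotone_operator_def scaleR_diff_right[symmetric])
    fix x w assume rel: "\<And>y v. v \<in> S y \<Longrightarrow> 0 \<le> (x - y) \<bullet> (w - v)"
    have "(1 / lam) *\<^sub>R (w + p) \<in> T x"
    proof (rule maximally_monotone_related[OF T])
      fix y v assume "v \<in> T y"
      then have "0 \<le> (x - y) \<bullet> (w - (lam *\<^sub>R v - p))" by (intro rel) (auto simp: S_def)
      also have "w - (lam *\<^sub>R v - p) = lam *\<^sub>R ((1 / lam) *\<^sub>R (w + p) - v)"
        using \<open>lam > 0\<close> by (simp add: algebra_simps)
      finally show "0 \<le> (x - y) \<bullet> ((1 / lam) *\<^sub>R (w + p) - v)"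
        using \<open>lam > 0\<close> by (simp add: zero_le_mult_iff)
    qed
    then show "w \<in> S x" using \<open>lam > 0\<close> by (auto simp: S_def image_iff intro!: bexI)
  qed
  then obtain z where "- z \<in> S z" by (rule minty_at_zero)
  then obtain u where u: "u \<in> T z" "- z = lam *\<^sub>R u - p" by (auto simp: S_def)
  have "z + lam *\<^sub>R u = z + (lam *\<^sub>R u - p) + p" by simp
  also have "\<dots> = p" unfolding u(2)[symmetric] by simp
  finally show ?thesis using u(1) that by blast
qed

section \<open>Asymptotic centers and weak convergence\<close>

text \<open>The \<open>r\<close> with this property are exactly the upper bounds of the limit superior of
  \<open>\<parallel>x\<^sub>k - z\<parallel>\<^sup>2 / 2\<close>, so the pairs \<open>(z, r)\<close> form the epigraph of a function that is strongly convex
  in \<open>z\<close>.\<close>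
definition asymptotic_bound :: "(nat \<Rightarrow> 'a::real_inner) \<Rightarrow> 'a \<Rightarrow> real \<Rightarrow> bool" where
  "asymptotic_bound x z r \<longleftrightarrow> (\<forall>e>0. \<forall>\<^sub>F k in sequentially. (norm (x k - z))\<^sup>2 / 2 < r + e)"

lemma asymptotic_bound_shift:
  assumes "asymptotic_bound x z r" and b: "b \<longlonglongrightarrow> \<beta>"
    and le: "\<And>k. (norm (x k - w))\<^sup>2 / 2 \<le> (norm (x k - z))\<^sup>2 / 2 + b k"
  shows "asymptotic_bound x w (r + \<beta>)"
  unfolding asymptotic_bound_def
proof (intro allI impI)
  fix e :: real assume "e > 0"
  then have "\<forall>\<^sub>F k in sequentially. (norm (x k - z))\<^sup>2 / 2 < r + e / 2"
    using assms(1)[unfolded asymptotic_bound_def, rule_format, of "e / 2"] by simp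
  moreover have "\<forall>\<^sub>F k in sequentially. b k < \<beta> + e / 2"
    using order_tendstoD(2)[OF b] \<open>e > 0\<close> by simp
  ultimately show "\<forall>\<^sub>F k in sequentially. (norm (x k - w))\<^sup>2 / 2 < r + \<beta> + e"
  proof eventually_elim
    case (elim k)
    then show ?case using le[of k] by linarith
  qed
qed

lemma asymptotic_bound_limit_iff:
  assumes "(\<lambda>k. (norm (x k - z))\<^sup>2 / 2) \<longlonglongrightarrow> l"
  shows "asymptotic_bound x z r \<longleftrightarrow> l \<le> r"
proof
  assume r: "asymptotic_bound x z r"
  show "l \<le> r"
  proof (rule field_le_epsilon)
    fix e :: real assume "e > 0"
    then have "\<forall>\<^sub>F k in sequentially. (norm (x k - z))\<^sup>2 / 2 \<le> r + e"
      using r by (auto simp: asymptotic_bound_def elim!: eventually_mono)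
    then show "l \<le> r + e" using tendsto_upperbound[OF assms] by simp
  qed
next
  assume "l \<le> r"
  then show "asymptotic_bound x z r"
    unfolding asymptotic_bound_def by (intro allI impI order_tendstoD(2)[OF assms]) simp
qed

text \<open>The asymptotic center of a bounded sequence minimizes the limit superior of the squared
  distances.  For a weakly convergent sequence it is the weak limit, so it serves as the candidate
  limit where one would otherwise extract weakly convergent subsequences.\<close>
lemma asymptotic_center:
  fixes x :: "nat \<Rightarrow> 'a::{real_inner, complete_space}"
  assumes "bounded (range x)"
  obtains c m where "asymptotic_bound x c m"
    and "\<And>z r. asymptotic_bound x z r \<Longrightarrow> m + (norm (z - c))\<^sup>2 / 2 \<le> r"
proof -
  obtain B where B: "\<And>k. norm (x k) \<le> B" using assms by (auto simp: bounded_iff)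
  define E where "E = {(z, r). asymptotic_bound x z r}"
  have "closed E"
    unfolding closed_sequential_limits
  proof (intro allI impI, elim conjE)
    fix p q assume p: "\<forall>n. p n \<in> E" and lim: "p \<longlonglongrightarrow> q"
    define z where "z = fst \<circ> p"
    define r where "r = snd \<circ> p"
    \<comment> \<open>\<open>dev n\<close> dominates the change of \<open>\<parallel>x\<^sub>k - z\<parallel>\<^sup>2 / 2\<close>, uniformly in \<open>k\<close>, when \<open>z n\<close> is replaced
      by its limit.\<close>
    define dev where "dev n = norm (z n - fst q) * (2 * (B + norm (fst q)) + norm (z n - fst q)) / 2" for n
    have pn: "asymptotic_bound x (z n) (r n)" for n
      using p[rule_format, of n] by (auto simp: E_def z_def r_def split_beta)
    have z: "z \<longlonglongrightarrow> fst q" and r: "r \<longlonglongrightarrow> snd q"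
      using tendsto_fst[OF lim] tendsto_snd[OF lim] by (simp_all add: z_def r_def comp_def)
    have "(\<lambda>n. r n + dev n) \<longlonglongrightarrow> snd q + norm (fst q - fst q) * (2 * (B + norm (fst q)) + norm (fst q - fst q)) / 2"
      unfolding dev_def by (intro tendsto_intros z r) simp
    then have lim_dev: "(\<lambda>n. r n + dev n) \<longlonglongrightarrow> snd q" by simp
    have shift: "(norm (x k - fst q))\<^sup>2 / 2 \<le> (norm (x k - z n))\<^sup>2 / 2 + dev n" for k n
    proof -
      have 1: "norm (x k - fst q) \<le> B + norm (fst q)"
        using norm_triangle_ineq4[of "x k" "fst q"] B[of k] by linarith
      have 2: "norm (x k - z n) \<le> norm (x k - fst q) + norm (z n - fst q)"
        using norm_triangle_ineq4[of "x k - fst q" "z n - fst q"] by simp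
      have 3: "norm (x k - fst q) \<le> norm (x k - z n) + norm (z n - fst q)"
        using norm_triangle_ineq[of "x k - z n" "z n - fst q"] by simp
      have "(norm (x k - fst q))\<^sup>2 - (norm (x k - z n))\<^sup>2
          = (norm (x k - fst q) - norm (x k - z n)) * (norm (x k - fst q) + norm (x k - z n))"
        by (simp add: power2_eq_square algebra_simps)
      also have "\<dots> \<le> norm (z n - fst q) * (2 * (B + norm (fst q)) + norm (z n - fst q))"
        using 1 2 3 by (intro mult_mono) auto
      finally show ?thesis by (simp add: dev_def)
    qed
    have "asymptotic_bound x (fst q) (snd q)"
      unfolding asymptotic_bound_def
    proof (intro allI impI)
      fix e :: real assume "e > 0"
      then have "\<forall>\<^sub>F n in sequentially. r n + dev n < snd q + e"
        using order_tendstoD(2)[OF lim_dev] by simp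
      then obtain n where n: "r n + dev n < snd q + e"
        using eventually_happens sequentially_bot by blast
      have "asymptotic_bound x (fst q) (r n + dev n)"
        by (rule asymptotic_bound_shift[OF pn tendsto_const shift])
      with n show "\<forall>\<^sub>F k in sequentially. (norm (x k - fst q))\<^sup>2 / 2 < snd q + e"
        unfolding asymptotic_bound_def
        by (elim allE[of _ "snd q + e - (r n + dev n)"]) simp
    qed
    then show "q \<in> E" by (simp add: E_def split_beta)
  qed
  moreover have "E \<noteq> {}"
  proof -
    have "(norm (x k - 0))\<^sup>2 / 2 < B\<^sup>2 / 2 + e" if "e > 0" for k e
      using power_mono[OF B[of k], of 2] that by simp
    then have "(0, B\<^sup>2 / 2) \<in> E" by (simp add: E_def asymptotic_bound_def)
    then show ?thesis by blast
  qed
  moreover have "bdd_below (snd ` E)"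
  proof (rule bdd_belowI)
    fix r assume "r \<in> snd ` E"
    then obtain z where z: "asymptotic_bound x z r" by (auto simp: E_def)
    show "0 \<le> r"
    proof (rule field_le_epsilon)
      fix e :: real assume "e > 0"
      then have "\<forall>\<^sub>F k in sequentially. (norm (x k - z))\<^sup>2 / 2 < r + e"
        using z by (simp add: asymptotic_bound_def)
      then obtain k where "(norm (x k - z))\<^sup>2 / 2 < r + e"
        using eventually_happens sequentially_bot by blast
      then show "0 \<le> r + e" using zero_le_power2[of "norm (x k - z)"] by linarith
    qed
  qed
  moreover have "((1 - t) *\<^sub>R z + t *\<^sub>R w, (1 - t) * r + t * s - t * (1 - t) / 2 * (norm (z - w))\<^sup>2) \<in> E"
    if "(z, r) \<in> E" "(w, s) \<in> E" and t: "0 \<le> t" "t \<le> 1" for z r w s t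
  proof -
    have "\<forall>\<^sub>F k in sequentially. (norm (x k - ((1 - t) *\<^sub>R z + t *\<^sub>R w)))\<^sup>2 / 2
        < (1 - t) * r + t * s - t * (1 - t) / 2 * (norm (z - w))\<^sup>2 + e" if "e > 0" for e
    proof -
      have "\<forall>\<^sub>F k in sequentially. (norm (x k - z))\<^sup>2 / 2 < r + e / 2"
        "\<forall>\<^sub>F k in sequentially. (norm (x k - w))\<^sup>2 / 2 < s + e / 2"
        using \<open>(z, r) \<in> E\<close> \<open>(w, s) \<in> E\<close> half_gt_zero[OF \<open>e > 0\<close>]
        unfolding E_def asymptotic_bound_def by blast+
      then show ?thesis
      proof eventually_elim
        case (elim k)
        have "x k - ((1 - t) *\<^sub>R z + t *\<^sub>R w) = (1 - t) *\<^sub>R (x k - z) + t *\<^sub>R (x k - w)"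
          by (simp add: algebra_simps)
        then have "(norm (x k - ((1 - t) *\<^sub>R z + t *\<^sub>R w)))\<^sup>2 = (1 - t) * (norm (x k - z))\<^sup>2
            + t * (norm (x k - w))\<^sup>2 - t * (1 - t) * (norm (z - w))\<^sup>2"
          by (simp only: norm_convex_combination_sq) (simp add: norm_minus_commute)
        then have "(norm (x k - ((1 - t) *\<^sub>R z + t *\<^sub>R w)))\<^sup>2 / 2 = (1 - t) * ((norm (x k - z))\<^sup>2 / 2)
            + t * ((norm (x k - w))\<^sup>2 / 2) - t * (1 - t) / 2 * (norm (z - w))\<^sup>2"
          by (simp add: field_simps)
        moreover have "(1 - t) * ((norm (x k - z))\<^sup>2 / 2) \<le> (1 - t) * (r + e / 2)"
          "t * ((norm (x k - w))\<^sup>2 / 2) \<le> t * (s + e / 2)"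
          using elim t by (intro mult_left_mono; simp)+
        moreover have "(1 - t) * (r + e / 2) + t * (s + e / 2) = (1 - t) * r + t * s + e / 2"
          by (simp add: field_simps)
        ultimately show ?case using \<open>e > 0\<close> by linarith
      qed
    qed
    then show ?thesis by (simp add: E_def asymptotic_bound_def)
  qed
  ultimately obtain c m where "(c, m) \<in> E" "\<And>z r. (z, r) \<in> E \<Longrightarrow> m + (norm (z - c))\<^sup>2 / 2 \<le> r"
    using strongly_convex_minimizer[of E] by blast
  then show ?thesis by (intro that[of c m]) (auto simp: E_def)
qed

text \<open>If \<open>x\<^sub>k\<close> is asymptotically fixed by a nonexpansive \<open>J\<close>, then \<open>J c\<close> is asymptotically as close to
  the sequence as \<open>c\<close>, and the minimizer is unique.\<close>
lemma asymptotic_center_fixed: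
  fixes x :: "nat \<Rightarrow> 'a::real_inner"
  assumes bdd: "bounded (range x)"
    and nonexpansive: "\<And>p q. norm (J p - J q) \<le> norm (p - q)"
    and regular: "(\<lambda>k. norm (x k - J (x k))) \<longlonglongrightarrow> 0"
    and c: "asymptotic_bound x c m"
      "\<And>z r. asymptotic_bound x z r \<Longrightarrow> m + (norm (z - c))\<^sup>2 / 2 \<le> r"
  shows "J c = c"
proof -
  obtain B where B: "\<And>k. norm (x k) \<le> B" using bdd by (auto simp: bounded_iff)
  define e where "e k = norm (x k - J (x k))" for k
  have "(\<lambda>k. e k * (B + norm c) + (e k)\<^sup>2 / 2) \<longlonglongrightarrow> 0 * (B + norm c) + 0\<^sup>2 / 2"
    using regular unfolding e_def by (intro tendsto_intros) auto
  moreover have "(norm (x k - J c))\<^sup>2 / 2 \<le> (norm (x k - c))\<^sup>2 / 2 + (e k * (B + norm c) + (e k)\<^sup>2 / 2)" for k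
  proof -
    have "norm (x k - J c) \<le> e k + norm (x k - c)"
      using norm_triangle_ineq[of "x k - J (x k)" "J (x k) - J c"] nonexpansive[of "x k" c]
      by (simp add: e_def)
    then have "(norm (x k - J c))\<^sup>2 \<le> (e k + norm (x k - c))\<^sup>2" by (rule power_mono) simp
    moreover have "e k * norm (x k - c) \<le> e k * (B + norm c)"
      using norm_triangle_ineq4[of "x k" c] B[of k] by (intro mult_left_mono) (auto simp: e_def)
    ultimately show ?thesis by (simp add: power2_sum)
  qed
  ultimately have "asymptotic_bound x (J c) (m + (0 * (B + norm c) + 0\<^sup>2 / 2))"
    by (rule asymptotic_bound_shift[OF c(1)])
  from c(2)[OF this] show ?thesis by simp
qed

text \<open>The center \<open>c\<close> of the whole sequence and the center \<open>d\<close> of any subsequence are both fixed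
  points, so the distances to each converge along the whole sequence.  Hence each of
  them is as good a center as the other, for the sequence and for the subsequence, and \<open>c = d\<close>.
  If weak convergence to \<open>c\<close> failed, then \<open>\<langle>x\<^sub>k - c, h\<rangle> \<ge> \<eta> > 0\<close> along some subsequence, and \<open>c + h\<close>
  would contradict the quadratic growth around its center \<open>c\<close>.\<close>
theorem opial_weak_convergence:
  fixes x :: "nat \<Rightarrow> 'a::{real_inner, complete_space}"
  assumes bdd: "bounded (range x)"
    and nonexpansive: "\<And>p q. norm (J p - J q) \<le> norm (p - q)"
    and regular: "(\<lambda>k. norm (x k - J (x k))) \<longlonglongrightarrow> 0"
    and conv: "\<And>z. J z = z \<Longrightarrow> convergent (\<lambda>k. norm (x k - z))"
  obtains c where "J c = c" "weakly_converges x c"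
proof -
  obtain c m where c: "asymptotic_bound x c m"
      "\<And>z r. asymptotic_bound x z r \<Longrightarrow> m + (norm (z - c))\<^sup>2 / 2 \<le> r"
    using asymptotic_center[OF bdd] by blast
  have Jc: "J c = c" by (rule asymptotic_center_fixed[OF bdd nonexpansive regular c])
  have no_sub: False if s: "strict_mono s" and away: "\<And>j. \<eta> \<le> (x (s j) - c) \<bullet> h" and "\<eta> > 0"
    for s :: "nat \<Rightarrow> nat" and h \<eta>
  proof -
    have bdd_s: "bounded (range (x \<circ> s))" by (rule bounded_subset[OF bdd]) auto
    obtain d n where d: "asymptotic_bound (x \<circ> s) d n"
        "\<And>z r. asymptotic_bound (x \<circ> s) z r \<Longrightarrow> n + (norm (z - d))\<^sup>2 / 2 \<le> r"
      using asymptotic_center[OF bdd_s] by blast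
    have "J d = d"
      by (rule asymptotic_center_fixed[OF bdd_s nonexpansive _ d])
        (use LIMSEQ_subseq_LIMSEQ[OF regular s] in \<open>simp add: comp_def\<close>)
    have lim: "\<exists>l. (\<lambda>k. (norm (x k - z))\<^sup>2 / 2) \<longlonglongrightarrow> l" if Jz: "J z = z" for z
    proof -
      obtain l where "(\<lambda>k. norm (x k - z)) \<longlonglongrightarrow> l" using conv[OF Jz] by (auto simp: convergent_def)
      then have "(\<lambda>k. (norm (x k - z))\<^sup>2 / 2) \<longlonglongrightarrow> l\<^sup>2 / 2" by (intro tendsto_intros) auto
      then show ?thesis by blast
    qed
    obtain l l' where l: "(\<lambda>k. (norm (x k - c))\<^sup>2 / 2) \<longlonglongrightarrow> l"
      and l': "(\<lambda>k. (norm (x k - d))\<^sup>2 / 2) \<longlonglongrightarrow> l'"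
      using lim[OF Jc] lim[OF \<open>J d = d\<close>] by blast
    have ls: "(\<lambda>k. (norm ((x \<circ> s) k - c))\<^sup>2 / 2) \<longlonglongrightarrow> l"
      and ls': "(\<lambda>k. (norm ((x \<circ> s) k - d))\<^sup>2 / 2) \<longlonglongrightarrow> l'"
      using LIMSEQ_subseq_LIMSEQ[OF l s] LIMSEQ_subseq_LIMSEQ[OF l' s] by (simp_all add: comp_def)
    have "l \<le> m" "m + (norm (d - c))\<^sup>2 / 2 \<le> l'"
      using asymptotic_bound_limit_iff[OF l] asymptotic_bound_limit_iff[OF l'] c by auto
    moreover have "l' \<le> n" "n + (norm (c - d))\<^sup>2 / 2 \<le> l"
      using asymptotic_bound_limit_iff[OF ls] asymptotic_bound_limit_iff[OF ls'] d unfolding comp_def by auto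
    ultimately have "(norm (d - c))\<^sup>2 \<le> 0" unfolding norm_minus_commute[of c d] by linarith
    then have "d = c" by simp
    have "(norm ((x \<circ> s) k - (c + h)))\<^sup>2 / 2 \<le> (norm ((x \<circ> s) k - c))\<^sup>2 / 2 + ((norm h)\<^sup>2 / 2 - \<eta>)" for k
    proof -
      have "(norm ((x \<circ> s) k - (c + h)))\<^sup>2 / 2
          = (norm ((x \<circ> s) k - c))\<^sup>2 / 2 - (x (s k) - c) \<bullet> h + (norm h)\<^sup>2 / 2"
        by (simp add: power2_norm_eq_inner inner_diff inner_add inner_commute field_simps)
      then show ?thesis using away[of k] by simp
    qed
    then have "asymptotic_bound (x \<circ> s) (c + h) (n + ((norm h)\<^sup>2 / 2 - \<eta>))"
      using asymptotic_bound_shift[OF d(1)[unfolded \<open>d = c\<close>] tendsto_const] by blast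
    from d(2)[OF this] show False using \<open>d = c\<close> \<open>\<eta> > 0\<close> by simp
  qed
  have ev: "\<forall>\<^sub>F k in sequentially. (x k - c) \<bullet> h < \<eta>" if "\<eta> > 0" for h \<eta>
  proof (rule ccontr)
    assume "\<not> ?thesis"
    then have "infinite {k. \<eta> \<le> (x k - c) \<bullet> h}"
      unfolding cofinite_eq_sequentially[symmetric] eventually_cofinite by (simp add: not_less)
    then obtain s :: "nat \<Rightarrow> nat" where "strict_mono s" "\<And>j. s j \<in> {k. \<eta> \<le> (x k - c) \<bullet> h}"
      using infinite_enumerate by blast
    then show False using no_sub[of s \<eta> h] that by auto
  qed
  have "weakly_converges x c"
    unfolding weakly_converges_def
  proof (intro allI impI)
    fix f :: "'a \<Rightarrow> real" assume f: "bounded_linear f"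
    then obtain h where h: "\<And>z. f z = z \<bullet> h" using riesz_representation by blast
    show "(\<lambda>k. f (x k)) \<longlonglongrightarrow> f c"
    proof (rule order_tendstoI)
      fix b assume "b < f c"
      then show "\<forall>\<^sub>F k in sequentially. b < f (x k)"
        using ev[of "f c - b" "- h"] by (simp add: h inner_diff)
    next
      fix b assume "f c < b"
      then show "\<forall>\<^sub>F k in sequentially. f (x k) < b"
        using ev[of "b - f c" h] by (simp add: h inner_diff)
    qed
  qed
  with Jc show ?thesis by (rule that)
qed

section \<open>Resolvents and Yosida regularizations\<close>

text \<open>Monotonicity alone gives uniqueness: solutions \<open>z, z'\<close> of \<open>z + lam u = p\<close> satisfy
  \<open>z' - z = - lam (u' - u)\<close>, so their monotonicity product is \<open>- lam \<parallel>u' - u\<parallel>\<^sup>2\<close>.\<close>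
lemma resolvent_eqI:
  assumes "monotone_operator T" and "lam > 0" and u: "u \<in> T z" "z + lam *\<^sub>R u = p"
  shows "resolvent lam T p = z"
proof -
  have "z' = z" if u': "u' \<in> T z'" "z' + lam *\<^sub>R u' = p" for z' u'
  proof -
    have diff: "z' - z = - lam *\<^sub>R (u' - u)"
      using u(2) u'(2) by (simp add: algebra_simps)
    have "0 \<le> (z' - z) \<bullet> (u' - u)"
      using assms(1) u(1) u'(1) unfolding monotone_operator_def by blast
    then have "lam * (norm (u' - u))\<^sup>2 \<le> 0"
      unfolding diff by (simp add: power2_norm_eq_inner)
    then have "u' - u = 0" using \<open>lam > 0\<close> by (simp add: mult_le_0_iff)
    then show ?thesis using diff by simp
  qed
  then have "inverse_operator (\<lambda>z. {z + lam *\<^sub>R u |u. u \<in> T z}) p = {z}"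
    using u unfolding inverse_operator_def by blast
  then show ?thesis by (simp add: resolvent_def)
qed

lemma yosida_in_resolvent:
  fixes T :: "'a::{real_inner, complete_space} \<Rightarrow> 'a set"
  assumes T: "maximally_monotone T" and "lam > 0"
  shows "yosida lam T p \<in> T (resolvent lam T p)"
proof -
  obtain z u where u: "u \<in> T z" "z + lam *\<^sub>R u = p" using minty[OF assms] by blast
  have "resolvent lam T p = z"
    using T \<open>lam > 0\<close> u resolvent_eqI[of T lam u z p] by (simp add: maximally_monotone_def)
  moreover from this have "yosida lam T p = u"
    using u(2)[symmetric] \<open>lam > 0\<close> by (simp add: yosida_def)
  ultimately show ?thesis using u(1) by simp
qed

lemma resolvent_fixed_iff:
  fixes T :: "'a::{real_inner, complete_space} \<Rightarrow> 'a set"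
  assumes T: "maximally_monotone T" and "lam > 0"
  shows "resolvent lam T z = z \<longleftrightarrow> z \<in> inverse_operator T 0"
proof
  assume "resolvent lam T z = z"
  then show "z \<in> inverse_operator T 0"
    using yosida_in_resolvent[OF assms, of z] by (simp add: yosida_def inverse_operator_def)
next
  assume "z \<in> inverse_operator T 0"
  then show "resolvent lam T z = z"
    using T \<open>lam > 0\<close>
    by (intro resolvent_eqI[of T lam 0]) (auto simp: inverse_operator_def maximally_monotone_def)
qed

lemma yosida_zero_iff:
  assumes "lam > 0"
  shows "yosida lam T z = 0 \<longleftrightarrow> resolvent lam T z = z"
  using assms by (auto simp: yosida_def)

context
  fixes T :: "'a::{real_inner, complete_space} \<Rightarrow> 'a set" and lam :: real
  assumes T: "maximally_monotone T" and lam: "lam > 0"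
begin

lemma diff_resolvent_yosida:
  "p - q = (resolvent lam T p - resolvent lam T q) + lam *\<^sub>R (yosida lam T p - yosida lam T q)"
  using lam by (simp add: yosida_def algebra_simps)

lemma resolvent_yosida_monotone:
  "0 \<le> (resolvent lam T p - resolvent lam T q) \<bullet> (yosida lam T p - yosida lam T q)"
  using T yosida_in_resolvent[OF T lam]
  unfolding maximally_monotone_def monotone_operator_def by blast

lemma yosida_monotone: "0 \<le> (p - q) \<bullet> (yosida lam T p - yosida lam T q)"
  unfolding diff_resolvent_yosida[of p q] inner_add_left inner_scaleR_left
  using resolvent_yosida_monotone lam by simp

text \<open>In the decomposition of \<open>p - q\<close> into its resolvent and Yosida parts, the two parts have a
  nonnegative inner product.\<close>
lemma resolvent_nonexpansive: "norm (resolvent lam T p - resolvent lam T q) \<le> norm (p - q)"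
proof (rule power2_le_imp_le)
  define v where "v = yosida lam T p - yosida lam T q"
  define w where "w = resolvent lam T p - resolvent lam T q"
  have "(norm (p - q))\<^sup>2 = (norm w)\<^sup>2 + 2 * lam * (w \<bullet> v) + lam\<^sup>2 * (norm v)\<^sup>2"
    unfolding diff_resolvent_yosida[of p q] v_def[symmetric] w_def[symmetric]
    by (simp add: power2_norm_eq_inner inner_add inner_commute power2_eq_square[of lam] algebra_simps)
  moreover have "0 \<le> w \<bullet> v" unfolding v_def w_def by (rule resolvent_yosida_monotone)
  ultimately show "(norm (resolvent lam T p - resolvent lam T q))\<^sup>2 \<le> (norm (p - q))\<^sup>2"
    using lam by (simp add: w_def)
qed simp

end

section \<open>The gap function\<close>

lemma gap_le:
  assumes "D > 0" and "\<And>y. y \<in> cball x0 D \<Longrightarrow> (p - y) \<bullet> yosida lam T y \<le> C"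
  shows "gap lam T x0 D p \<le> C"
  unfolding gap_def using assms by (intro cSUP_least) auto

context
  fixes T :: "'a::{real_inner, complete_space} \<Rightarrow> 'a set" and lam D :: real
  assumes T: "maximally_monotone T" and lam: "lam > 0" and D: "D > 0"
begin

text \<open>Monotonicity replaces \<open>A y\<close> by \<open>A p\<close>, which gives a bound uniform in \<open>y\<close>.  It also shows that
  the supremum defining the gap is finite.\<close>
lemma gap_integrand_le:
  assumes "y \<in> cball x0 D"
  shows "(p - y) \<bullet> yosida lam T y \<le> (norm (p - x0) + D) * norm (yosida lam T p)"
proof -
  have "(p - y) \<bullet> yosida lam T y \<le> (p - y) \<bullet> yosida lam T p"
    using yosida_monotone[OF T lam, of p y] by (simp add: inner_diff_right)
  also have "\<dots> \<le> norm (p - y) * norm (yosida lam T p)" by (rule norm_cauchy_schwarz)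
  also have "norm (p - y) \<le> norm (p - x0) + D"
    using norm_triangle_ineq[of "p - x0" "x0 - y"] assms by (simp add: dist_norm)
  finally show ?thesis by (simp add: mult_right_mono)
qed

lemma gap_le_residual: "gap lam T x0 D p \<le> (norm (p - x0) + D) * norm (yosida lam T p)"
  using gap_integrand_le by (intro gap_le D)

text \<open>At these points \<open>y\<close> the expression in the supremum vanishes.\<close>
lemma gap_nonneg:
  assumes "y \<in> cball x0 D" and "yosida lam T y = 0 \<or> y = p"
  shows "0 \<le> gap lam T x0 D p"
proof -
  have "bdd_above ((\<lambda>y. (p - y) \<bullet> yosida lam T y) ` cball x0 D)"
    using gap_integrand_le by (rule bdd_aboveI2)
  then have "(p - y) \<bullet> yosida lam T y \<le> gap lam T x0 D p"
    unfolding gap_def using assms(1) by (rule cSUP_upper2) simp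
  then show ?thesis using assms(2) by auto
qed

end

section \<open>The inexact proximal point iteration\<close>

text \<open>Only monotonicity of the single-valued map \<open>A\<close> and the existence of a zero enter the
  estimates; that \<open>A\<close> is a Yosida regularization matters only for the weak limit and the gap.\<close>
locale inexact_proximal_point =
  fixes A :: "'a::real_inner \<Rightarrow> 'a" and x g :: "nat \<Rightarrow> 'a" and a \<delta> :: "nat \<Rightarrow> real" and sol :: 'a
  assumes mono: "0 \<le> (p - q) \<bullet> (A p - A q)"
    and sol: "A sol = 0"
    and a_pos: "a (Suc k) > 0"
    and summable_\<delta>: "summable \<delta>"
    and g_le: "norm (g k) \<le> \<delta> k"
    and step: "a (Suc k) *\<^sub>R A (x (Suc k)) = x k - x (Suc k) - g k"
begin

lemma \<delta>_nonneg: "0 \<le> \<delta> k"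
  using g_le[of k] norm_ge_zero order_trans by blast

lemma inner_zero_nonneg: "A z = 0 \<Longrightarrow> 0 \<le> (x k - z) \<bullet> A (x k)"
  using mono[of "x k" z] by simp

text \<open>The point \<open>x\<^sub>k\<^sub>+\<^sub>1\<close> arises from \<open>x\<^sub>k - g\<^sub>k\<close> by a resolvent step, which does not increase the
  distance to a zero.\<close>
lemma quasi_fejer:
  assumes "A z = 0"
  shows "norm (x (Suc k) - z) \<le> norm (x k - z) + \<delta> k"
proof (cases "x (Suc k) = z")
  case False
  have "0 \<le> (x (Suc k) - z) \<bullet> (a (Suc k) *\<^sub>R A (x (Suc k)))"
    using inner_zero_nonneg[OF assms, of "Suc k"] a_pos[of k] by simp
  then have "(norm (x (Suc k) - z))\<^sup>2 \<le> (x (Suc k) - z) \<bullet> (x k - z - g k)"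
    unfolding step by (simp add: power2_norm_eq_inner inner_diff inner_commute algebra_simps)
  also have "\<dots> \<le> norm (x (Suc k) - z) * norm (x k - z - g k)" by (rule norm_cauchy_schwarz)
  finally have "norm (x (Suc k) - z) \<le> norm (x k - z - g k)"
    using False by (simp add: power2_eq_square)
  also have "\<dots> \<le> norm (x k - z) + \<delta> k"
    using norm_triangle_ineq4[of "x k - z" "g k"] g_le[of k] by simp
  finally show ?thesis .
qed (simp add: \<delta>_nonneg)

lemma convergent_distance:
  assumes "A z = 0"
  shows "convergent (\<lambda>k. norm (x k - z))"
proof -
  \<comment> \<open>Subtracting the errors accumulated so far makes the distances decreasing.\<close>
  define d where "d k = norm (x k - z) - sum \<delta> {..<k}" for k
  have "decseq d"
    unfolding d_def using quasi_fejer[OF assms] by (intro decseq_SucI) (simp add: algebra_simps)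
  moreover have "- suminf \<delta> \<le> d k" for k
    using sum_le_suminf[OF summable_\<delta> finite_lessThan[of k] \<delta>_nonneg] norm_ge_zero[of "x k - z"]
    unfolding d_def by linarith
  ultimately have "convergent d" using decseq_convergent convergentI by metis
  then have "convergent (\<lambda>k. d k + sum \<delta> {..<k})"
    using summable_\<delta> by (intro convergent_add) (simp_all add: summable_iff_convergent)
  then show ?thesis by (simp add: d_def)
qed

lemma bounded_iterates: "bounded (range x)"
proof -
  obtain B where "\<And>k. norm (x k - sol) \<le> B"
    using convergent_imp_Bseq[OF convergent_distance[OF sol]] by (auto simp: Bseq_def)
  then have "norm (x k) \<le> B + norm sol" for k
    using norm_triangle_ineq[of "x k - sol" sol] by (smt (verit) diff_add_cancel)
  then show ?thesis by (auto simp: bounded_iff)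
qed

text \<open>The step equation paired with \<open>x\<^sub>k\<^sub>+\<^sub>1 - y\<close>, for an arbitrary \<open>y\<close>: a zero \<open>y\<close> yields the
  summability of the squared steps, a point \<open>y\<close> of the ball the bound for the averaged gap.\<close>
lemma energy_le:
  assumes R: "\<And>k. norm (x k - y) \<le> R"
  shows "2 * a (Suc k) * ((x (Suc k) - y) \<bullet> A (x (Suc k))) + (norm (x (Suc k) - x k))\<^sup>2
    \<le> (norm (x k - y))\<^sup>2 - (norm (x (Suc k) - y))\<^sup>2 + 2 * R * \<delta> k"
proof -
  have "a (Suc k) * ((x (Suc k) - y) \<bullet> A (x (Suc k))) = (x (Suc k) - y) \<bullet> (x k - x (Suc k) - g k)"
    by (simp add: step[symmetric])
  also have "2 * \<dots> = (norm (x k - y))\<^sup>2 - (norm (x (Suc k) - y))\<^sup>2 - (norm (x (Suc k) - x k))\<^sup>2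
      + 2 * ((x (Suc k) - y) \<bullet> (- g k))"
    by (simp add: power2_norm_eq_inner inner_diff inner_commute algebra_simps)
  also have "(x (Suc k) - y) \<bullet> (- g k) \<le> norm (x (Suc k) - y) * norm (- g k)"
    by (rule norm_cauchy_schwarz)
  also have "\<dots> \<le> R * \<delta> k"
    using R[of "Suc k"] g_le[of k] order_trans[OF norm_ge_zero R[of 0]] by (intro mult_mono) auto
  finally show ?thesis by (simp add: algebra_simps)
qed

lemma energy_sum_le:
  assumes R: "\<And>k. norm (x k - y) \<le> R"
  shows "(\<Sum>i<n. 2 * a (Suc i) * ((x (Suc i) - y) \<bullet> A (x (Suc i))) + (norm (x (Suc i) - x i))\<^sup>2)
    \<le> (norm (x 0 - y))\<^sup>2 + 2 * R * suminf \<delta>"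
proof -
  have "(\<Sum>i<n. 2 * a (Suc i) * ((x (Suc i) - y) \<bullet> A (x (Suc i))) + (norm (x (Suc i) - x i))\<^sup>2)
      \<le> (\<Sum>i<n. (norm (x i - y))\<^sup>2 - (norm (x (Suc i) - y))\<^sup>2 + 2 * R * \<delta> i)"
    by (intro sum_mono energy_le R)
  also have "\<dots> = (norm (x 0 - y))\<^sup>2 - (norm (x n - y))\<^sup>2 + 2 * R * sum \<delta> {..<n}"
    by (simp only: sum.distrib sum_distrib_left sum_lessThan_telescope'[where f = "\<lambda>i. (norm (x i - y))\<^sup>2"])
  also have "\<dots> \<le> (norm (x 0 - y))\<^sup>2 + 2 * R * suminf \<delta>"
    using sum_le_suminf[OF summable_\<delta>, of "{..<n}"] \<delta>_nonneg order_trans[OF norm_ge_zero R[of 0]]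
    by (intro add_mono mult_left_mono) auto
  finally show ?thesis .
qed

lemma steps_sum_le:
  assumes "\<And>k. norm (x k - sol) \<le> R"
  shows "(\<Sum>i<n. (norm (x (Suc i) - x i))\<^sup>2) \<le> (norm (x 0 - sol))\<^sup>2 + 2 * R * suminf \<delta>"
proof -
  have "(\<Sum>i<n. (norm (x (Suc i) - x i))\<^sup>2)
    \<le> (\<Sum>i<n. 2 * a (Suc i) * ((x (Suc i) - sol) \<bullet> A (x (Suc i))) + (norm (x (Suc i) - x i))\<^sup>2)"
    using inner_zero_nonneg[OF sol] a_pos by (intro sum_mono) (simp add: less_imp_le)
  then show ?thesis using energy_sum_le[OF assms] by (rule order_trans)
qed

text \<open>The bound is uniform over a ball of points \<open>y\<close> because the gap is a supremum over a ball.\<close>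
lemma uniform_distance_bound:
  obtains R where "\<And>k y. norm (y - p) \<le> D \<Longrightarrow> norm (x k - y) \<le> R"
proof -
  obtain B where B: "\<And>k. norm (x k) \<le> B" using bounded_iterates by (auto simp: bounded_iff)
  show ?thesis
  proof
    fix k y assume "norm (y - p) \<le> D"
    then show "norm (x k - y) \<le> B + norm p + D"
      using B[of k] norm_triangle_ineq4[of "x k - p" "y - p"] norm_triangle_ineq4[of "x k" p] by simp
  qed
qed

lemma steps_square_bound:
  obtains C where "\<And>n. (\<Sum>i<n. (norm (x (Suc i) - x i))\<^sup>2) \<le> C"
proof -
  obtain R where "\<And>k y. norm (y - sol) \<le> 0 \<Longrightarrow> norm (x k - y) \<le> R"
    using uniform_distance_bound[of sol 0] by blast
  then have "\<And>k. norm (x k - sol) \<le> R" by simp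
  from that[OF steps_sum_le[OF this]] show ?thesis .
qed

lemma summable_steps: "summable (\<lambda>i. (norm (x (Suc i) - x i))\<^sup>2)"
proof -
  obtain C where "\<And>n. (\<Sum>i<n. (norm (x (Suc i) - x i))\<^sup>2) \<le> C" using steps_square_bound by blast
  then show ?thesis by (intro bounded_imp_summable[of _ C]) (simp_all only: lessThan_Suc_atMost[symmetric] zero_le_power2)
qed

lemma scaled_residual_tendsto_0: "(\<lambda>k. a (Suc k) * norm (A (x (Suc k)))) \<longlonglongrightarrow> 0"
proof -
  have "(\<lambda>k. sqrt ((norm (x (Suc k) - x k))\<^sup>2)) \<longlonglongrightarrow> sqrt 0"
    by (intro tendsto_real_sqrt summable_LIMSEQ_zero summable_steps)
  then have "(\<lambda>k. norm (x (Suc k) - x k) + \<delta> k) \<longlonglongrightarrow> 0 + 0"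
    by (intro tendsto_add summable_LIMSEQ_zero[OF summable_\<delta>]) simp
  then have lim: "(\<lambda>k. norm (x (Suc k) - x k) + \<delta> k) \<longlonglongrightarrow> 0" by simp
  have "a (Suc k) * norm (A (x (Suc k))) \<le> norm (x (Suc k) - x k) + \<delta> k" for k
  proof -
    have "a (Suc k) * norm (A (x (Suc k))) = norm (x k - x (Suc k) - g k)"
      using a_pos[of k] by (simp add: step[symmetric])
    also have "\<dots> \<le> norm (x k - x (Suc k)) + norm (g k)" by (rule norm_triangle_ineq4)
    also have "\<dots> \<le> norm (x (Suc k) - x k) + \<delta> k" using g_le[of k] by (simp add: norm_minus_commute)
    finally show ?thesis .
  qed
  then show ?thesis
    using a_pos by (intro tendsto_sandwich[OF _ _ tendsto_const lim]) (auto simp: less_imp_le)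
qed

lemma residual_smallo: "(\<lambda>k. norm (A (x (Suc k)))) \<in> o(\<lambda>k. 1 / a (Suc k))"
proof (rule smalloI_tendsto)
  show "(\<lambda>k. norm (A (x (Suc k))) / (1 / a (Suc k))) \<longlonglongrightarrow> 0"
    using scaled_residual_tendsto_0 by (simp add: mult.commute)
  show "\<forall>\<^sub>F k in sequentially. 1 / a (Suc k) \<noteq> 0" using a_pos by (simp add: less_imp_neq[symmetric])
qed

text \<open>By monotonicity \<open>\<langle>x\<^sub>i - y, A y\<rangle> \<le> \<langle>x\<^sub>i - y, A x\<^sub>i\<rangle>\<close>, and the left-hand side is affine in \<open>x\<^sub>i\<close>, so
  averaging passes inside it.\<close>
lemma ergodic_inner_le:
  assumes "norm (y - x 0) \<le> D" and R: "\<And>k. norm (x k - y) \<le> R"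
  shows "((1 / (\<Sum>i=0..k. a (Suc i))) *\<^sub>R (\<Sum>i=0..k. a (Suc i) *\<^sub>R x (Suc i)) - y) \<bullet> A y
    \<le> (D\<^sup>2 / 2 + R * suminf \<delta>) / (\<Sum>i=0..k. a (Suc i))"
proof -
  define s where "s = (\<Sum>i=0..k. a (Suc i))"
  have "s > 0" unfolding s_def using a_pos by (intro sum_pos) auto
  then have "(1 / s) *\<^sub>R (\<Sum>i=0..k. a (Suc i) *\<^sub>R x (Suc i)) - y
      = (1 / s) *\<^sub>R ((\<Sum>i=0..k. a (Suc i) *\<^sub>R x (Suc i)) - s *\<^sub>R y)"
    by (simp add: scaleR_diff_right)
  also have "(\<Sum>i=0..k. a (Suc i) *\<^sub>R x (Suc i)) - s *\<^sub>R y = (\<Sum>i=0..k. a (Suc i) *\<^sub>R (x (Suc i) - y))"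
    by (simp add: s_def scaleR_sum_left sum_subtractf scaleR_diff_right)
  finally have average: "((1 / s) *\<^sub>R (\<Sum>i=0..k. a (Suc i) *\<^sub>R x (Suc i)) - y) \<bullet> A y
      = (\<Sum>i=0..k. a (Suc i) * ((x (Suc i) - y) \<bullet> A y)) / s"
    by (simp add: inner_sum_left)
  have "2 * (\<Sum>i=0..k. a (Suc i) * ((x (Suc i) - y) \<bullet> A y))
      \<le> (\<Sum>i<Suc k. 2 * a (Suc i) * ((x (Suc i) - y) \<bullet> A (x (Suc i))) + (norm (x (Suc i) - x i))\<^sup>2)"
    unfolding sum_distrib_left atLeast0AtMost lessThan_Suc_atMost
  proof (rule sum_mono)
    fix i
    have "a (Suc i) * ((x (Suc i) - y) \<bullet> A y) \<le> a (Suc i) * ((x (Suc i) - y) \<bullet> A (x (Suc i)))"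
      using mono[of "x (Suc i)" y] a_pos[of i] by (simp add: inner_diff_right)
    then show "2 * (a (Suc i) * ((x (Suc i) - y) \<bullet> A y))
        \<le> 2 * a (Suc i) * ((x (Suc i) - y) \<bullet> A (x (Suc i))) + (norm (x (Suc i) - x i))\<^sup>2"
      unfolding mult.assoc using zero_le_power2[of "norm (x (Suc i) - x i)"] by linarith
  qed
  also have "\<dots> \<le> (norm (x 0 - y))\<^sup>2 + 2 * R * suminf \<delta>" by (rule energy_sum_le[OF R])
  also have "(norm (x 0 - y))\<^sup>2 \<le> D\<^sup>2"
    using assms(1) by (intro power_mono) (simp_all add: norm_minus_commute)
  finally have "(\<Sum>i=0..k. a (Suc i) * ((x (Suc i) - y) \<bullet> A y)) \<le> D\<^sup>2 / 2 + R * suminf \<delta>" by simp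
  then show ?thesis
    unfolding s_def[symmetric] average using \<open>s > 0\<close> by (intro divide_right_mono) auto
qed

text \<open>Since the steps are exactly \<open>- a\<^sub>k\<^sub>+\<^sub>1 A(x\<^sub>k\<^sub>+\<^sub>1)\<close>, monotonicity between consecutive iterates makes
  the residuals decrease, and the sum of the \<open>a\<^sub>i\<^sup>2 \<parallel>A x\<^sub>i\<parallel>\<^sup>2\<close>, being that of the squared steps, stays
  bounded.\<close>
lemma residual_bigo_exact:
  assumes exact: "\<And>k. \<delta> k = 0"
  shows "(\<lambda>k. norm (A (x (Suc k)))) \<in> O(\<lambda>k. 1 / sqrt (\<Sum>i=0..k. (a (Suc i))\<^sup>2))"
proof -
  have exact_step: "a (Suc k) *\<^sub>R A (x (Suc k)) = x k - x (Suc k)" for k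
    using step[of k] g_le[of k] exact[of k] by simp
  have "norm (A (x (Suc (Suc k)))) \<le> norm (A (x (Suc k)))" for k
  proof (cases "A (x (Suc (Suc k))) = 0")
    case False
    let ?u = "A (x (Suc k))" and ?v = "A (x (Suc (Suc k)))"
    have "x (Suc (Suc k)) - x (Suc k) = - (a (Suc (Suc k)) *\<^sub>R ?v)" by (simp add: exact_step)
    then have "0 \<le> - (a (Suc (Suc k)) *\<^sub>R ?v) \<bullet> (?v - ?u)"
      using mono[of "x (Suc (Suc k))" "x (Suc k)"] by simp
    then have "?v \<bullet> (?v - ?u) \<le> 0" using a_pos[of "Suc k"] by (simp add: mult_le_0_iff)
    then have "(norm ?v)\<^sup>2 \<le> ?v \<bullet> ?u" by (simp add: power2_norm_eq_inner inner_diff_right)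
    also have "\<dots> \<le> norm ?v * norm ?u" by (rule norm_cauchy_schwarz)
    finally show ?thesis using False by (simp add: power2_eq_square)
  qed simp
  then have dec: "decseq (\<lambda>k. norm (A (x (Suc k))))" by (rule decseq_SucI)
  obtain C where C: "\<And>n. (\<Sum>i<n. (norm (x (Suc i) - x i))\<^sup>2) \<le> C" using steps_square_bound by blast
  show ?thesis
  proof (rule bigoI[where c = "sqrt C"], rule always_eventually, rule allI)
    fix k
    define s where "s = (\<Sum>i=0..k. (a (Suc i))\<^sup>2)"
    have "s > 0" unfolding s_def using a_pos by (intro sum_pos) (auto simp: less_imp_neq[symmetric])
    have "(norm (A (x (Suc k))))\<^sup>2 * s \<le> (\<Sum>i=0..k. (norm (x (Suc i) - x i))\<^sup>2)"
      unfolding s_def sum_distrib_left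
    proof (rule sum_mono)
      fix i assume "i \<in> {0..k}"
      then have "norm (A (x (Suc k))) \<le> norm (A (x (Suc i)))" using decseqD[OF dec] by simp
      then have "(norm (A (x (Suc k))) * a (Suc i))\<^sup>2 \<le> (norm (A (x (Suc i))) * a (Suc i))\<^sup>2"
        using a_pos[of i] by (intro power_mono mult_right_mono) auto
      also have "norm (A (x (Suc i))) * a (Suc i) = norm (x i - x (Suc i))"
        using a_pos[of i] by (simp add: exact_step[symmetric])
      finally show "(norm (A (x (Suc k))))\<^sup>2 * (a (Suc i))\<^sup>2 \<le> (norm (x (Suc i) - x i))\<^sup>2"
        by (simp add: power_mult_distrib norm_minus_commute)
    qed
    also have "\<dots> \<le> C" using C[of "Suc k"] by (simp only: atLeast0AtMost lessThan_Suc_atMost)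
    finally have "sqrt ((norm (A (x (Suc k))))\<^sup>2 * s) \<le> sqrt C" by (rule real_sqrt_le_mono)
    then have "norm (A (x (Suc k))) * sqrt s \<le> sqrt C" by (simp add: real_sqrt_mult)
    then show "norm (norm (A (x (Suc k)))) \<le> sqrt C * norm (1 / sqrt (\<Sum>i=0..k. (a (Suc i))\<^sup>2))"
      using \<open>s > 0\<close> by (simp add: s_def[symmetric] pos_le_divide_eq)
  qed
qed

end

section \<open>Rates and weak convergence for the Yosida regularization\<close>

theorem theorem1:
  fixes T :: "'a::{real_inner, complete_space} \<Rightarrow> 'a set"
    and xs :: 'a and x g :: "nat \<Rightarrow> 'a" and a \<delta> :: "nat \<Rightarrow> real" and lam \<epsilon> D :: real
  assumes T: "maximally_monotone T"
    and zeros: "inverse_operator T 0 \<noteq> {}" "bounded (inverse_operator T 0)"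
    and D: "D > 0"
    and xs: "xs \<in> inverse_operator T 0"
    and lambda: "lam > 0"
    and a: "\<epsilon> > 0" "\<And>k. a (Suc k) \<ge> \<epsilon>"
    and delta: "\<And>k. \<delta> k \<ge> 0" "summable \<delta>"
    and g: "\<And>k. norm (g k) \<le> \<delta> k"
    and iter: "\<And>k. 0 = a (Suc k) *\<^sub>R yosida lam T (x (Suc k)) + x (Suc k) - x k + g k"
  shows
    "bounded (range x) \<and>
     summable (\<lambda>i. (norm (x (Suc i) - x i))\<^sup>2) \<and>
     ((\<lambda>k. norm (yosida lam T (x (Suc k)))) \<in> o(\<lambda>k. 1 / a (Suc k)) \<and>
      le_smallo (\<lambda>k. gap lam T (x 0) D (x (Suc k))) (\<lambda>k. 1 / a (Suc k)) \<and>
      (inverse_operator T 0 \<inter> cball (x 0) D \<noteq> {} \<or>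
       (\<forall>\<^sub>F k in sequentially. x (Suc k) \<in> cball (x 0) D) \<longrightarrow>
        (\<lambda>k. gap lam T (x 0) D (x (Suc k))) \<in> o(\<lambda>k. 1 / a (Suc k)))) \<and>
     le_bigo
       (\<lambda>k. gap lam T (x 0) D
              ((1 / (\<Sum>i=0..k. a (Suc i))) *\<^sub>R (\<Sum>i=0..k. a (Suc i) *\<^sub>R x (Suc i))))
       (\<lambda>k. 1 / (\<Sum>i=0..k. a (Suc i))) \<and>
     (\<exists>z \<in> inverse_operator T 0. weakly_converges x z) \<and>
     ((\<forall>k. \<delta> k = 0) \<longrightarrow>
        (\<lambda>k. norm (yosida lam T (x (Suc k)))) \<in> O(\<lambda>k. 1 / sqrt (\<Sum>i=0..k. (a (Suc i))\<^sup>2)) \<and>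
        le_bigo (\<lambda>k. gap lam T (x 0) D (x (Suc k)))
          (\<lambda>k. 1 / sqrt (\<Sum>i=0..k. (a (Suc i))\<^sup>2)))"
proof -
  let ?A = "yosida lam T" and ?J = "resolvent lam T"
  have A_zero: "?A z = 0 \<longleftrightarrow> z \<in> inverse_operator T 0" for z
    using yosida_zero_iff[OF lambda] resolvent_fixed_iff[OF T lambda] by blast
  interpret inexact_proximal_point ?A x g a \<delta> xs
  proof
    show "0 \<le> (p - q) \<bullet> (?A p - ?A q)" for p q by (rule yosida_monotone[OF T lambda])
    show "?A xs = 0" using A_zero xs by simp
    show "0 < a (Suc k)" for k using a(1) a(2)[of k] by linarith
    show "a (Suc k) *\<^sub>R ?A (x (Suc k)) = x k - x (Suc k) - g k" for k
    proof -
      have "a (Suc k) *\<^sub>R ?A (x (Suc k)) = a (Suc k) *\<^sub>R ?A (x (Suc k)) - 0" by simp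
      also have "\<dots> = x k - x (Suc k) - g k" by (subst iter[of k]) (simp add: algebra_simps)
      finally show ?thesis .
    qed
  qed (fact delta(2), fact g)
  obtain R where R: "\<And>k y. norm (y - x 0) \<le> D \<Longrightarrow> norm (x k - y) \<le> R"
    using uniform_distance_bound[of "x 0" D] by blast
  let ?res = "\<lambda>k. norm (?A (x (Suc k)))" and ?gap = "\<lambda>k. gap lam T (x 0) D (x (Suc k))"
  have gap_bound: "?gap k \<le> (R + D) * ?res k" for k
  proof -
    have "?gap k \<le> (norm (x (Suc k) - x 0) + D) * ?res k" by (rule gap_le_residual[OF T lambda D])
    also have "\<dots> \<le> (R + D) * ?res k" using R[of "x 0"] D by (intro mult_right_mono) auto
    finally show ?thesis .
  qed
  have scaled_residual_o: "(\<lambda>k. (R + D) * ?res k) \<in> o(\<lambda>k. 1 / a (Suc k))"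
    using residual_smallo by simp
  \<comment> \<open>The bound above is one-sided; either alternative makes the gap eventually nonnegative.\<close>
  have gap_smallo: "?gap \<in> o(\<lambda>k. 1 / a (Suc k))"
    if "inverse_operator T 0 \<inter> cball (x 0) D \<noteq> {} \<or>
       (\<forall>\<^sub>F k in sequentially. x (Suc k) \<in> cball (x 0) D)"
  proof -
    have "\<forall>\<^sub>F k in sequentially. 0 \<le> ?gap k"
      using that
    proof
      assume "inverse_operator T 0 \<inter> cball (x 0) D \<noteq> {}"
      then obtain z where "z \<in> cball (x 0) D" "?A z = 0" using A_zero by blast
      then show ?thesis using gap_nonneg[OF T lambda D] by (intro always_eventually) blast
    next
      assume "\<forall>\<^sub>F k in sequentially. x (Suc k) \<in> cball (x 0) D"
      then show ?thesis by eventually_elim (use gap_nonneg[OF T lambda D] in blast)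
    qed
    then have "\<forall>\<^sub>F k in sequentially. norm (?gap k) \<le> 1 * norm ((R + D) * ?res k)"
    proof eventually_elim
      case (elim k)
      then show ?case using gap_bound[of k] by simp
    qed
    then have "?gap \<in> O(\<lambda>k. (R + D) * ?res k)" by (rule bigoI)
    then show ?thesis using scaled_residual_o by (rule landau_o.big_small_trans)
  qed
  have weak: "\<exists>z \<in> inverse_operator T 0. weakly_converges x z"
  proof -
    \<comment> \<open>Here \<open>x - J x = lam A x\<close>, and \<open>a \<ge> \<epsilon>\<close> lets the scaled residual control \<open>A x\<close>.\<close>
    have "(\<lambda>k. norm (x k - ?J (x k))) \<longlonglongrightarrow> 0"
    proof (rule LIMSEQ_imp_Suc)
      have lim: "(\<lambda>k. lam / \<epsilon> * (a (Suc k) * ?res k)) \<longlonglongrightarrow> lam / \<epsilon> * 0"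
        by (intro tendsto_intros scaled_residual_tendsto_0)
      have "norm (x (Suc k) - ?J (x (Suc k))) \<le> lam / \<epsilon> * (a (Suc k) * ?res k)" for k
      proof -
        have "norm (x (Suc k) - ?J (x (Suc k))) = lam * ?res k"
          using lambda by (simp add: yosida_def)
        also have "\<dots> = lam / \<epsilon> * (\<epsilon> * ?res k)" using a(1) by simp
        also have "\<dots> \<le> lam / \<epsilon> * (a (Suc k) * ?res k)"
          using lambda a by (intro mult_left_mono mult_right_mono) auto
        finally show ?thesis .
      qed
      then show "(\<lambda>k. norm (x (Suc k) - ?J (x (Suc k)))) \<longlonglongrightarrow> 0"
        using lim by (intro tendsto_sandwich[OF _ _ tendsto_const lim[simplified]]) auto
    qed
    moreover have "convergent (\<lambda>k. norm (x k - z))" if "?J z = z" for z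
      using that yosida_zero_iff[OF lambda] convergent_distance by blast
    ultimately obtain z where "?J z = z" "weakly_converges x z"
      using opial_weak_convergence[OF bounded_iterates resolvent_nonexpansive[OF T lambda]] by blast
    then show ?thesis using resolvent_fixed_iff[OF T lambda] by blast
  qed
  let ?s = "\<lambda>k. \<Sum>i=0..k. a (Suc i)"
  have ergodic: "gap lam T (x 0) D ((1 / ?s k) *\<^sub>R (\<Sum>i=0..k. a (Suc i) *\<^sub>R x (Suc i)))
      \<le> (D\<^sup>2 / 2 + R * suminf \<delta>) * (1 / ?s k)" for k
    using ergodic_inner_le R by (intro gap_le D) (auto simp: dist_norm norm_minus_commute)
  show ?thesis
  proof (intro conjI impI)
    show "bounded (range x)" by (rule bounded_iterates)
    show "summable (\<lambda>i. (norm (x (Suc i) - x i))\<^sup>2)" by (rule summable_steps)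
    show "?res \<in> o(\<lambda>k. 1 / a (Suc k))" by (rule residual_smallo)
    show "le_smallo ?gap (\<lambda>k. 1 / a (Suc k))"
      unfolding le_smallo_def using scaled_residual_o gap_bound
      by (intro bexI[of _ "\<lambda>k. (R + D) * ?res k"]) auto
    show "le_bigo (\<lambda>k. gap lam T (x 0) D ((1 / ?s k) *\<^sub>R (\<Sum>i=0..k. a (Suc i) *\<^sub>R x (Suc i))))
        (\<lambda>k. 1 / ?s k)"
      unfolding le_bigo_def using ergodic
      by (intro bexI[of _ "\<lambda>k. (D\<^sup>2 / 2 + R * suminf \<delta>) * (1 / ?s k)"]) (auto intro!: bigoI[where c = "\<bar>D\<^sup>2 / 2 + R * suminf \<delta>\<bar>"] simp: abs_mult)
    show "?res \<in> O(\<lambda>k. 1 / sqrt (\<Sum>i=0..k. (a (Suc i))\<^sup>2))" if "\<forall>k. \<delta> k = 0"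
      using that by (intro residual_bigo_exact) simp
    then show "le_bigo ?gap (\<lambda>k. 1 / sqrt (\<Sum>i=0..k. (a (Suc i))\<^sup>2))" if "\<forall>k. \<delta> k = 0"
      unfolding le_bigo_def using that gap_bound
      by (intro bexI[of _ "\<lambda>k. (R + D) * ?res k"]) auto
  qed (fact gap_smallo weak)+
qed

end
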